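(* Let $p\geq3$, $\lambda=\lambda_p=2\cos(\pi/p)$, and for real $x$ define $\rho(x)=TS^{-r(x)}(x)=\frac{1}{r(x)\lambda-x}$ where $r(x)=\lfloor x/\lambda\rfloor+1$. Then: (i) for every hyperbolic fixed point $\alpha$ of $G_p$ there is $n\ge0$ such that $\rho^n(\alpha)$ is $G_p$-reduced; (ii) $\rho$ maps $G_p$-reduced numbers to $G_p$-reduced numbers, and every $G_p$-reduced $\beta$ satisfies $\rho^m(\beta)=\beta$ for some $m\ge1$, so the reduced numbers fall into disjoint $\rho$-cycles; (iii) if $\beta,\gamma$ are $G_p$-reduced and $\gamma=V\beta$ for some $V\in G_p$, then $\gamma=\rho^n(\beta)$ for some $n\ge0$. Consequently each $G_p$-equivalence class of hyperbolic fixed points contains exactly one cycle of $G_p$-reduced numbers.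
   Context: Let $S=\begin{pmatrix}1&\lambda\\0&1\end{pmatrix}$, $T=\begin{pmatrix}0&-1\\1&0\end{pmatrix}$, and $G_p=\langle S,T\rangle/\{\pm I\}$ acting on $\mathbb{R}\cup\{\infty\}$ by linear fractional transformations. A hyperbolic fixed point is a real number fixed by an element of $G_p$ with $|{\rm trace}|>2$; two such points $\alpha,\beta$ are $G_p$-equivalent if $\beta=V\alpha$ for some $V\in G_p$. The $\lambda$-continued fraction of a real $\alpha$: $\alpha_0=\alpha$, $r_j=\lfloor\alpha_j/\lambda\rfloor+1$, $\alpha_{j+1}=\frac{1}{r_j\lambda-\alpha_j}$, so $\alpha=r_0\lambda-\cfrac{1}{r_1\lambda-\cfrac{1}{r_2\lambda-\cdots}}$. A real number is $G_p$-reduced if its $\lambda$-continued fraction is purely periodic with period other than $(2,1,\dots,1)$ with $p-3$ ones.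
   Formalization: "Period other than (2,1,…,1)" is taken to exclude all cyclic shifts of that block as well; otherwise (ii) fails, e.g. for p=4, β=1/√2 has period (1,2) but ρ(β)=√2 has the excluded period (2,1). *)

theory Defs
  imports Complex_Main
begin

text \<open>2x2 real matrices as tuples (a,b,c,d) representing [[a,b],[c,d]].\<close>
type_synonym mat2 = "real \<times> real \<times> real \<times> real"

definition lam :: "nat \<Rightarrow> real" where
  "lam p = 2 * cos (pi / real p)"

definition mmul :: "mat2 \<Rightarrow> mat2 \<Rightarrow> mat2" where
  "mmul M N = (case M of (a,b,c,d) \<Rightarrow> case N of (e,f,g,h) \<Rightarrow>
      (a*e + b*g, a*f + b*h, c*e + d*g, c*f + d*h))"

definition Smat :: "nat \<Rightarrow> mat2" where "Smat p = (1, lam p, 0, 1)"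
definition Sinv :: "nat \<Rightarrow> mat2" where "Sinv p = (1, - lam p, 0, 1)"
definition Tmat :: mat2 where "Tmat = (0, -1, 1, 0)"

text \<open>The matrix group generated by S and T (T^{-1} = T^3, so closure under
  left multiplication by S, S^{-1}, T suffices). The projective group G_p is
  its image modulo \<open>\<plusminus>I\<close>; since \<open>\<plusminus>V\<close> act identically, we work with matrices.\<close>
inductive_set Gp :: "nat \<Rightarrow> mat2 set" for p :: nat where
  Id: "(1,0,0,1) \<in> Gp p"
| S: "V \<in> Gp p \<Longrightarrow> mmul (Smat p) V \<in> Gp p"
| Si: "V \<in> Gp p \<Longrightarrow> mmul (Sinv p) V \<in> Gp p"
| T: "V \<in> Gp p \<Longrightarrow> mmul Tmat V \<in> Gp p"

definition trace2 :: "mat2 \<Rightarrow> real" where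
  "trace2 M = (case M of (a,b,c,d) \<Rightarrow> a + d)"

definition acts_real :: "mat2 \<Rightarrow> real \<Rightarrow> bool" where
  "acts_real M x = (case M of (a,b,c,d) \<Rightarrow> c*x + d \<noteq> 0)"

definition moeb :: "mat2 \<Rightarrow> real \<Rightarrow> real" where
  "moeb M x = (case M of (a,b,c,d) \<Rightarrow> (a*x + b) / (c*x + d))"

definition hyp_fixed :: "nat \<Rightarrow> real \<Rightarrow> bool" where
  "hyp_fixed p \<alpha> = (\<exists>V \<in> Gp p. \<bar>trace2 V\<bar> > 2 \<and> acts_real V \<alpha> \<and> moeb V \<alpha> = \<alpha>)"

definition Gp_equiv :: "nat \<Rightarrow> real \<Rightarrow> real \<Rightarrow> bool" where
  "Gp_equiv p \<alpha> \<beta> = (\<exists>V \<in> Gp p. acts_real V \<alpha> \<and> \<beta> = moeb V \<alpha>)"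

definition rr :: "nat \<Rightarrow> real \<Rightarrow> int" where
  "rr p x = \<lfloor>x / lam p\<rfloor> + 1"

definition rho :: "nat \<Rightarrow> real \<Rightarrow> real" where
  "rho p x = 1 / (real_of_int (rr p x) * lam p - x)"

fun cf_alpha :: "nat \<Rightarrow> real \<Rightarrow> nat \<Rightarrow> real" where
  "cf_alpha p \<alpha> 0 = \<alpha>"
| "cf_alpha p \<alpha> (Suc j) =
     1 / (real_of_int (\<lfloor>cf_alpha p \<alpha> j / lam p\<rfloor> + 1) * lam p - cf_alpha p \<alpha> j)"

definition cf_digit :: "nat \<Rightarrow> real \<Rightarrow> nat \<Rightarrow> int" where
  "cf_digit p \<alpha> j = \<lfloor>cf_alpha p \<alpha> j / lam p\<rfloor> + 1"

definition purely_periodic :: "nat \<Rightarrow> real \<Rightarrow> bool" where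
  "purely_periodic p \<alpha> = (\<exists>k \<ge> 1. \<forall>j. cf_digit p \<alpha> (j + k) = cf_digit p \<alpha> j)"

text \<open>The excluded period (2,1,...,1) with p-3 ones, of length p-2; we exclude
  every digit sequence that is the periodic repetition of this block (up to
  cyclic shift).\<close>
definition special_period :: "nat \<Rightarrow> real \<Rightarrow> bool" where
  "special_period p \<alpha> = (\<exists>s. \<forall>j. cf_digit p \<alpha> j =
      (if (j + s) mod (p - 2) = 0 then 2 else 1))"

definition reduced :: "nat \<Rightarrow> real \<Rightarrow> bool" where
  "reduced p \<alpha> = (purely_periodic p \<alpha> \<and> \<not> special_period p \<alpha>)"

end

theory Submission
  imports Defs
begin

text \<open>Tracking the matrices that realise the powers of \<open>\<rho>\<close>, one finds for every \<open>V\<close> in the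
  group and every real \<open>x\<close> with \<open>V x\<close> finite that the tails of the expansions of \<open>x\<close> and \<open>V x\<close>
  agree, by an agreement inducing \<open>\<plusminus>V\<close>; this needs to be checked on the generators only, plus
  the parabolic \<open>T S T\<close> at \<open>0\<close> for words that pass through infinity. Applied to \<open>V \<alpha> = \<alpha>\<close> with
  \<open>V \<noteq> \<plusminus>I\<close> this yields eventual periodicity without using discreteness of the group, and applied
  to equivalent reduced numbers it yields uniqueness of the cycle. The excluded period belongs
  to \<open>\<lambda>\<close>, the first point of \<open>[\<lambda>,\<infinity>)\<close> on the orbit of \<open>0\<close>. The stabilizer of \<open>0\<close> contains no
  hyperbolic elements, because along that orbit the second column \<open>(u,v)\<close> of the matrices keeps
  \<open>u\<^sup>2 - \<lambda>uv + v\<^sup>2 = 1\<close>. Finally, digits determine a number, since \<open>\<rho>\<close> expands over blocks ending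
  in a digit at least 2.\<close>

section \<open>Algebra of 2x2 matrices and the group\<close>

definition msmult :: "real \<Rightarrow> mat2 \<Rightarrow> mat2" where
  "msmult k M = (case M of (a,b,c,d) \<Rightarrow> (k*a, k*b, k*c, k*d))"

definition mdet :: "mat2 \<Rightarrow> real" where
  "mdet M = (case M of (a,b,c,d) \<Rightarrow> a*d - b*c)"

definition madj :: "mat2 \<Rightarrow> mat2" where
  "madj M = (case M of (a,b,c,d) \<Rightarrow> (d,-b,-c,a))"

abbreviation mone :: mat2 where "mone \<equiv> (1,0,0,1)"

lemma mmul_assoc: "mmul (mmul A B) C = mmul A (mmul B C)"
  by (cases A; cases B; cases C) (simp add: mmul_def algebra_simps)

lemma mmul_one [simp]: "mmul mone A = A" "mmul A mone = A"
  by (cases A; simp add: mmul_def)+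

lemma mmul_msmult [simp]:
  "mmul (msmult k A) B = msmult k (mmul A B)" "mmul A (msmult k B) = msmult k (mmul A B)"
  by (cases A; cases B; simp add: mmul_def msmult_def algebra_simps)+

lemma msmult_msmult [simp]: "msmult k (msmult l A) = msmult (k*l) A"
  by (cases A) (simp add: msmult_def)

lemma msmult_one [simp]: "msmult 1 A = A"
  by (cases A) (simp add: msmult_def)

lemma mdet_mmul: "mdet (mmul A B) = mdet A * mdet B"
  by (cases A; cases B) (simp add: mmul_def mdet_def algebra_simps)

lemma madj_inverse:
  assumes "mdet A = 1"
  shows "mmul (madj A) A = mone" "mmul A (madj A) = mone"
  using assms by (cases A; simp add: mmul_def mdet_def madj_def algebra_simps)+

lemma trace2_mmul_commute: "trace2 (mmul A B) = trace2 (mmul B A)"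
  by (cases A; cases B) (simp add: mmul_def trace2_def algebra_simps)

lemma mdet_Gp: "V \<in> Gp p \<Longrightarrow> mdet V = 1"
  by (induction rule: Gp.induct)
     (simp_all add: mdet_mmul, simp_all add: mdet_def Smat_def Sinv_def Tmat_def)

lemma cf_alpha_eq_rho: "cf_alpha p x j = (rho p ^^ j) x"
  by (induction j) (simp_all add: rho_def rr_def)

lemma cf_digit_eq_rr: "cf_digit p x j = rr p ((rho p ^^ j) x)"
  by (simp add: cf_digit_def rr_def cf_alpha_eq_rho)

lemma cf_digit_rho: "cf_digit p ((rho p ^^ n) x) j = cf_digit p x (j + n)"
  by (simp add: cf_digit_eq_rr funpow_add)

section \<open>Chebyshev values at \<open>\<theta> = pi / p\<close>\<close>

locale hecke =
  fixes p :: nat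
  assumes p_ge_3: "p \<ge> 3"
begin

abbreviation l :: real where "l \<equiv> lam p"
abbreviation \<rho> :: "real \<Rightarrow> real" where "\<rho> \<equiv> rho p"

definition \<theta> :: real where "\<theta> = pi / real p"

text \<open>This is the Chebyshev polynomial of the second kind of degree \<open>j - 1\<close> at
  \<open>cos \<theta>\<close>. These values are, up to sign, the matrix entries of the powers of the
  elliptic map \<open>x \<mapsto> 1 / (l - x)\<close>.\<close>

definition s :: "nat \<Rightarrow> real" where "s j = sin (real j * \<theta>) / sin \<theta>"

lemma theta_bounds: "0 < \<theta>" "\<theta> \<le> pi / 3"
  using p_ge_3 by (auto simp: \<theta>_def field_simps)

lemma sin_theta_pos: "sin \<theta> > 0"
  using theta_bounds pi_gt_zero by (intro sin_gt_zero) linarith+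

lemma s_0 [simp]: "s 0 = 0" and s_1 [simp]: "s (Suc 0) = 1"
  using sin_theta_pos by (auto simp: s_def)

lemma s_rec: "s (Suc (Suc j)) = l * s (Suc j) - s j"
proof -
  have "sin (real (Suc (Suc j)) * \<theta>) + sin (real j * \<theta>) = 2 * cos \<theta> * sin (real (Suc j) * \<theta>)"
    using sin_add[of "real (Suc j) * \<theta>" \<theta>] sin_diff[of "real (Suc j) * \<theta>" \<theta>]
    by (simp add: algebra_simps)
  then have "sin (real (Suc (Suc j)) * \<theta>) = l * sin (real (Suc j) * \<theta>) - sin (real j * \<theta>)"
    by (simp add: lam_def \<theta>_def)
  then show ?thesis
    by (simp add: s_def diff_divide_distrib)
qed

text \<open>The angle \<open>j * \<theta>\<close> lies between \<open>\<theta>\<close> and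
  \<open>pi - \<theta>\<close>, and on that interval the sine is smallest at the two ends.\<close>

lemma s_ge_1:
  assumes "0 < j" "j < p" shows "1 \<le> s j"
proof -
  have p0: "real p > 0" using p_ge_3 by simp
  have th: "real p * \<theta> = pi" using p0 by (simp add: \<theta>_def)
  have "1 * \<theta> \<le> real j * \<theta>"
    using assms theta_bounds by (intro mult_right_mono) auto
  then have lo: "\<theta> \<le> real j * \<theta>" by simp
  have "(real j + 1) * \<theta> \<le> real p * \<theta>"
    using assms theta_bounds by (intro mult_right_mono) auto
  then have hi: "real j * \<theta> \<le> pi - \<theta>" using th by (simp add: algebra_simps)
  have "sin \<theta> \<le> sin (real j * \<theta>)"
  proof (cases "real j * \<theta> \<le> pi / 2")
    case True
    then show ?thesis using lo theta_bounds
      by (intro sin_monotone_2pi_le) (auto intro: order_trans[of _ 0])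
  next
    case False
    then have "sin \<theta> \<le> sin (pi - real j * \<theta>)"
      using hi theta_bounds by (intro sin_monotone_2pi_le) (auto simp: field_simps)
    then show ?thesis by simp
  qed
  then show ?thesis using sin_theta_pos by (simp add: s_def field_simps)
qed

lemma s_p: "s p = 0" and s_p_minus_1: "s (p - 1) = 1" and s_p_minus_2: "s (p - 2) = l"
proof -
  have th: "real p * \<theta> = pi" using p_ge_3 by (simp add: \<theta>_def)
  show 0: "s p = 0" by (simp add: s_def th)
  have "real (p - 1) * \<theta> = pi - \<theta>"
    using p_ge_3 th by (simp add: of_nat_diff algebra_simps)
  then show 1: "s (p - 1) = 1" using sin_theta_pos by (simp add: s_def)
  have "Suc (Suc (p - 2)) = p" "Suc (p - 2) = p - 1" using p_ge_3 by auto
  then show "s (p - 2) = l" using s_rec[of "p - 2"] 0 1 by simp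
qed

lemma s_nonneg: "j \<le> p \<Longrightarrow> 0 \<le> s j"
  using s_ge_1[of j] s_p by (cases "j = 0 \<or> j = p") auto

text \<open>The form \<open>u^2 - l*u*v + v^2\<close> is invariant under the recursion step
  \<open>(u, v) \<mapsto> (v, l*v - u)\<close> and equals 1 at \<open>(0, 1)\<close>.\<close>

lemma s_norm: "(s j)\<^sup>2 - l * s j * s (Suc j) + (s (Suc j))\<^sup>2 = 1"
  by (induction j) (simp_all add: s_rec power2_eq_square algebra_simps)

lemma l_ge_1: "l \<ge> 1"
  using s_ge_1[of "p - 2"] s_p_minus_2 p_ge_3 by simp

section \<open>Digits, and the cells cut out by the orbit of 0\<close>

lemma rr_eqI: "real_of_int k * l - l \<le> x \<Longrightarrow> x < real_of_int k * l \<Longrightarrow> rr p x = k"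
  using l_ge_1 unfolding rr_def
  by (subst floor_unique[of "k - 1"]) (auto simp: field_simps)

lemma rr_bounds: "real_of_int (rr p x) * l - l \<le> x" "x < real_of_int (rr p x) * l"
proof -
  have "real_of_int \<lfloor>x / l\<rfloor> \<le> x / l" "x / l < real_of_int \<lfloor>x / l\<rfloor> + 1"
    by linarith+
  then have "real_of_int \<lfloor>x / l\<rfloor> * l \<le> x" "x < (real_of_int \<lfloor>x / l\<rfloor> + 1) * l"
    using l_ge_1 by (simp_all only: pos_le_divide_eq pos_divide_less_eq)
  then show "real_of_int (rr p x) * l - l \<le> x" "x < real_of_int (rr p x) * l"
    by (simp_all add: rr_def algebra_simps)
qed

lemma rho_ge: "\<rho> x \<ge> 1 / l"
  using rr_bounds[of x] l_ge_1 by (simp add: rho_def frac_le)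

lemma rho_pos: "\<rho> x > 0"
  using rho_ge[of x] l_ge_1 by (smt (verit) divide_pos_pos)

lemma inverse_rho: "1 / \<rho> x = real_of_int (rr p x) * l - x"
  by (simp add: rho_def)

text \<open>The points \<open>s i / s (i + 1)\<close> form the orbit of \<open>0\<close> under \<open>x \<mapsto> 1 / (l - x)\<close>;
  they cut \<open>[0,\<infinity>)\<close> into \<open>p - 1\<close> cells which that map shifts. The last cell is
  unbounded because \<open>s p = 0\<close>.\<close>

definition cell :: "nat \<Rightarrow> real \<Rightarrow> bool" where
  "cell i y \<longleftrightarrow> i \<le> p - 2 \<and> s i \<le> y * s (Suc i) \<and> y * s (Suc (Suc i)) < s (Suc i)"

lemma cell_last_iff:
  assumes "cell i y" shows "i = p - 2 \<longleftrightarrow> l \<le> y"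
proof
  assume "i = p - 2"
  moreover have "Suc (p - 2) = p - 1" using p_ge_3 by simp
  ultimately show "l \<le> y" using assms s_p_minus_2 s_p_minus_1 by (simp add: cell_def)
next
  assume y: "l \<le> y"
  show "i = p - 2"
  proof (rule ccontr)
    assume "i \<noteq> p - 2"
    then have i: "i + 3 \<le> p" using assms by (auto simp: cell_def)
    have "l * s (Suc (Suc i)) \<le> y * s (Suc (Suc i))"
      using y s_nonneg[of "Suc (Suc i)"] i by (intro mult_right_mono) auto
    also have "\<dots> < s (Suc i)" using assms by (simp add: cell_def)
    finally have "s (Suc (Suc (Suc i))) < 0" by (simp add: s_rec)
    then show False using s_nonneg[of "Suc (Suc (Suc i))"] i by auto
  qed
qed

lemma cell_nonneg:
  assumes "cell i y" shows "0 \<le> y"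
proof -
  have "Suc i < p" using assms p_ge_3 by (auto simp: cell_def)
  then have "0 < s (Suc i)" "0 \<le> s i"
    using s_ge_1[of "Suc i"] s_nonneg[of i] by auto
  then show ?thesis using assms by (smt (verit) cell_def zero_less_mult_pos mult_nonneg_nonpos2 mult_neg_pos)
qed

lemma cell_step:
  assumes "cell i y" "i \<noteq> p - 2"
  shows "rr p y = 1" "\<rho> y = 1 / (l - y)" "cell (Suc i) (\<rho> y)"
proof -
  have y: "0 \<le> y" "y < l" using cell_nonneg cell_last_iff assms by (auto simp: not_le[symmetric])
  show r: "rr p y = 1" using y by (intro rr_eqI) auto
  then show rho: "\<rho> y = 1 / (l - y)" by (simp add: rho_def)
  have "s (Suc i) * (l - y) \<le> s (Suc (Suc i))" "s (Suc (Suc (Suc i))) < s (Suc (Suc i)) * (l - y)"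
    using assms(1) by (simp_all add: cell_def s_rec algebra_simps)
  then show "cell (Suc i) (\<rho> y)"
    using y assms by (auto simp: cell_def rho field_simps)
qed

lemma cell_exists:
  assumes "1 / l \<le> y" shows "\<exists>i\<ge>1. cell i y"
proof -
  \<comment> \<open>The largest index meeting the lower cell bound also meets the upper one. The
    search can start at 1 because \<open>s 1 / s 2 = 1 / l\<close>.\<close>
  define Q where "Q i \<longleftrightarrow> 1 \<le> i \<and> i \<le> p - 2 \<and> s i \<le> y * s (Suc i)" for i
  have "s (Suc (Suc 0)) = l" by (simp add: s_rec)
  then have "Q 1" using assms p_ge_3 l_ge_1 by (auto simp: Q_def field_simps)
  moreover have "\<forall>i. Q i \<longrightarrow> i \<le> p - 2" by (simp add: Q_def)
  ultimately have "\<exists>i. Q i \<and> (\<forall>j. Q j \<longrightarrow> j \<le> i)"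
    by (metis (no_types, lifting) Nat.ex_has_greatest_nat)
  then obtain i where i: "Q i" "\<And>j. Q j \<Longrightarrow> j \<le> i" by blast
  have "y * s (Suc (Suc i)) < s (Suc i)"
  proof (cases "i = p - 2")
    case True
    then have "Suc (Suc i) = p" "Suc i = p - 1" using p_ge_3 by auto
    then show ?thesis using s_p s_p_minus_1 by simp
  next
    case False
    then have "\<not> Q (Suc i)" "Suc i \<le> p - 2" using i(1) i(2)[of "Suc i"] by (auto simp: Q_def)
    then show ?thesis by (auto simp: Q_def)
  qed
  then show ?thesis using i by (auto simp: Q_def cell_def)
qed

lemma cell_iterate:
  assumes "cell i x" "\<And>j. j < t \<Longrightarrow> (\<rho> ^^ j) x < l"
  shows "cell (i + t) ((\<rho> ^^ t) x)"
  using assms(2)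
proof (induction t)
  case (Suc t)
  then have "cell (i + t) ((\<rho> ^^ t) x)" "(\<rho> ^^ t) x < l" by auto
  then show ?case using cell_step(3) cell_last_iff by fastforce
qed (use assms(1) in simp)

text \<open>Every point below \<open>l\<close> raises the cell index by one, and that index never
  exceeds \<open>p - 2\<close>.\<close>

lemma iterate_reaches_l:
  assumes "1 / l \<le> x" shows "\<exists>t. l \<le> (\<rho> ^^ t) x"
proof (rule ccontr)
  assume "\<not> ?thesis"
  then have less: "(\<rho> ^^ t) x < l" for t by (auto simp: not_le)
  obtain i where "cell i x" using cell_exists assms by blast
  then have "cell (i + p) ((\<rho> ^^ p) x)" using cell_iterate less by blast
  then show False using p_ge_3 by (auto simp: cell_def)
qed

text \<open>The lower cell bounds telescope along the block, and the block ends in cell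
  \<open>p - 2\<close>, where \<open>s\<close> takes the value \<open>l\<close>. A gap between two
  points grows by two such products.\<close>

lemma block_prod_ge:
  assumes "1 / l \<le> x" "\<And>j. j < t \<Longrightarrow> (\<rho> ^^ j) x < l" "l \<le> (\<rho> ^^ t) x"
  shows "(\<rho> ^^ t) x / l \<le> (\<Prod>j\<le>t. (\<rho> ^^ j) x)"
proof -
  obtain i where i: "1 \<le> i" "cell i x" using cell_exists assms by blast
  have "1 \<le> (\<Prod>j<k. (\<rho> ^^ j) x) * s (i + k)" if "k \<le> t" for k
    using that
  proof (induction k)
    case 0
    then show ?case using i s_ge_1[of i] p_ge_3 by (auto simp: cell_def)
  next
    case (Suc k)
    have c: "cell (i + k) ((\<rho> ^^ k) x)" using cell_iterate i assms(2) Suc by auto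
    have "0 \<le> (\<Prod>j<k. (\<rho> ^^ j) x)"
    proof (intro prod_nonneg)
      fix j assume "j \<in> {..<k}"
      then have "cell (i + j) ((\<rho> ^^ j) x)" using cell_iterate i assms(2) Suc by auto
      then show "0 \<le> (\<rho> ^^ j) x" by (rule cell_nonneg)
    qed
    then have "(\<Prod>j<k. (\<rho> ^^ j) x) * s (i + k) \<le> (\<Prod>j<k. (\<rho> ^^ j) x) * ((\<rho> ^^ k) x * s (Suc (i + k)))"
      using c by (intro mult_left_mono) (auto simp: cell_def)
    then show ?case using Suc by (simp add: mult_ac)
  qed
  moreover have "i + t = p - 2"
    using cell_last_iff cell_iterate[OF i(2) assms(2)] assms(3) by blast
  ultimately have *: "1 \<le> (\<Prod>j<t. (\<rho> ^^ j) x) * l" using s_p_minus_2 by force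
  have "(\<rho> ^^ t) x * 1 \<le> (\<rho> ^^ t) x * ((\<Prod>j<t. (\<rho> ^^ j) x) * l)"
    using assms(3) l_ge_1 * by (intro mult_left_mono) auto
  then show ?thesis using l_ge_1
    by (simp add: lessThan_Suc_atMost[symmetric] field_simps)
qed

section \<open>Growth of gaps; digits determine the number\<close>

lemma inverse_diff_iterate:
  assumes "0 < x" "0 < y" "\<And>j. rr p ((\<rho> ^^ j) x) = rr p ((\<rho> ^^ j) y)"
  shows "1 / (\<rho> ^^ n) x - 1 / (\<rho> ^^ n) y =
    (1 / x - 1 / y) * (\<Prod>j<n. (\<rho> ^^ j) x) * (\<Prod>j<n. (\<rho> ^^ j) y)"
proof (induction n)
  case (Suc n)
  have pos: "(\<rho> ^^ n) x > 0" "(\<rho> ^^ n) y > 0"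
    using assms(1,2) rho_pos by (cases n; simp)+
  \<comment> \<open>Equal digits cancel in the difference of the reciprocals.\<close>
  have "1 / (\<rho> ^^ Suc n) x - 1 / (\<rho> ^^ Suc n) y = (\<rho> ^^ n) y - (\<rho> ^^ n) x"
    by (simp add: inverse_rho assms(3))
  also have "\<dots> = (1 / (\<rho> ^^ n) x - 1 / (\<rho> ^^ n) y) * (\<rho> ^^ n) x * (\<rho> ^^ n) y"
    using pos by (simp add: field_simps)
  finally show ?case by (simp add: Suc mult_ac)
qed simp

text \<open>Over a block of digits \<open>1,\<dots>,1,r\<close> with \<open>r \<ge> 2\<close> the gap \<open>1/x - 1/y\<close> between two
  points with the same digits grows by a definite amount, although the blocks
  \<open>2,1,\<dots>,1\<close> are only parabolic.\<close>

lemma gap_grows: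
  assumes "1 / l \<le> x" "x < y" "\<And>j. rr p ((\<rho> ^^ j) x) = rr p ((\<rho> ^^ j) y)"
  defines "F \<equiv> 1 / x - 1 / y"
  shows "\<exists>n. F + F\<^sup>2 / l \<le> 1 / (\<rho> ^^ n) x - 1 / (\<rho> ^^ n) y \<and>
             1 / l \<le> (\<rho> ^^ n) x \<and> (\<rho> ^^ n) x < (\<rho> ^^ n) y"
proof -
  have l0: "l > 0" using l_ge_1 by simp
  then have x0: "0 < x" using assms(1) by (smt (verit) divide_pos_pos)
  then have F0: "F > 0" using assms(2) by (simp add: F_def field_simps)
  define t where "t = (LEAST t. l \<le> (\<rho> ^^ t) x)"
  have tx: "l \<le> (\<rho> ^^ t) x"
    unfolding t_def by (rule LeastI_ex) (use iterate_reaches_l assms(1) in blast)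
  have jx: "(\<rho> ^^ j) x < l" if "j < t" for j
    using not_less_Least[of j "\<lambda>t. l \<le> (\<rho> ^^ t) x"] that by (auto simp: t_def)
  \<comment> \<open>Lying in \<open>[l,\<infinity>)\<close> is visible from the digit, so both
    blocks end at the same index.\<close>
  have same: "l \<le> (\<rho> ^^ j) x \<longleftrightarrow> l \<le> (\<rho> ^^ j) y" for j
  proof -
    have "l \<le> z \<longleftrightarrow> rr p z \<ge> 2" for z
    proof -
      have "rr p z \<ge> 2 \<longleftrightarrow> 1 \<le> z / l" unfolding rr_def by linarith
      then show ?thesis using l0 by (simp add: field_simps)
    qed
    then show ?thesis using assms(3) by simp
  qed
  have block_x: "(\<rho> ^^ t) x / l \<le> (\<Prod>j\<le>t. (\<rho> ^^ j) x)"
    using block_prod_ge assms(1) jx tx by blast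
  have "\<And>j. j < t \<Longrightarrow> (\<rho> ^^ j) y < l" using jx same by (meson not_le)
  then have block_y: "(\<rho> ^^ t) y / l \<le> (\<Prod>j\<le>t. (\<rho> ^^ j) y)"
    using block_prod_ge[of y t] assms(1,2) tx same by auto
  define X where "X = (\<rho> ^^ t) x"
  define Y where "Y = (\<rho> ^^ t) y"
  define G where "G = Y - X"
  have X: "l \<le> X" and Y: "l \<le> Y" using tx same by (auto simp: X_def Y_def)
  have G_eq: "1 / (\<rho> ^^ Suc t) x - 1 / (\<rho> ^^ Suc t) y = G"
    by (simp add: inverse_rho assms(3) G_def X_def Y_def)
  have Xl: "0 \<le> X / l" and Yl: "0 \<le> Y / l" using X Y l0 by simp_all
  have FX: "F * (X / l) \<le> F * (\<Prod>j\<le>t. (\<rho> ^^ j) x)"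
    using block_x F0 by (intro mult_left_mono) (simp_all add: X_def)
  moreover have "0 \<le> F * (X / l)" using Xl F0 by (intro mult_nonneg_nonneg) simp_all
  ultimately have "0 \<le> F * (\<Prod>j\<le>t. (\<rho> ^^ j) x)" by linarith
  note bounds = mult_mono[OF FX block_y[folded Y_def] this Yl]
  have "F * 1 * (Y / l) \<le> F * (X / l) * (Y / l)"
    using X Y F0 l0 by (intro mult_right_mono mult_left_mono) auto
  also note bounds
  also have "F * (\<Prod>j\<le>t. (\<rho> ^^ j) x) * (\<Prod>j\<le>t. (\<rho> ^^ j) y) = G"
    using inverse_diff_iterate[of x y "Suc t"] x0 assms(2,3)
    by (simp only: G_eq F_def lessThan_Suc_atMost)
  finally have G1: "F * (Y / l) \<le> G" by simp
  have "F * 1 \<le> F * (Y / l)" using F0 Y l0 by (intro mult_left_mono) auto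
  then have FG: "F \<le> G" using G1 by simp
  \<comment> \<open>Feeding \<open>F \<le> G\<close> back in: since \<open>X\<close> is at least
    \<open>l\<close>, the larger point \<open>Y\<close> exceeds \<open>l\<close> by at least
    \<open>F\<close>, which supplies the quadratic term.\<close>
  have "l + F \<le> Y" using X FG by (simp add: G_def)
  then have "F * ((l + F) / l) \<le> F * (Y / l)"
    using F0 l0 by (intro mult_left_mono divide_right_mono) auto
  moreover have "F * ((l + F) / l) = F + F\<^sup>2 / l"
    using l0 by (simp add: field_simps power2_eq_square)
  ultimately have big: "F + F\<^sup>2 / l \<le> G" using G1 by simp
  have "1 / (\<rho> ^^ Suc t) y < 1 / (\<rho> ^^ Suc t) x" using FG F0 G_eq by linarith
  then have "(\<rho> ^^ Suc t) x < (\<rho> ^^ Suc t) y"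
    using rho_pos by (simp add: field_simps)
  then show ?thesis using big G_eq rho_ge by (intro exI[of _ "Suc t"]) auto
qed

text \<open>Each application of \<open>gap_grows\<close> adds at least \<open>F^2 / l\<close> to the
  gap, whereas points above \<open>1 / l\<close> have reciprocals in \<open>(0, l]\<close>, so the
  gap stays below \<open>l\<close>.\<close>

lemma digits_not_less:
  assumes "1 / l \<le> x" "\<And>j. rr p ((\<rho> ^^ j) x) = rr p ((\<rho> ^^ j) y)"
  shows "\<not> x < y"
proof
  assume xy: "x < y"
  have l0: "l > 0" using l_ge_1 by simp
  then have x0: "0 < x" using assms(1) by (smt (verit) divide_pos_pos)
  define F where "F = 1 / x - 1 / y"
  have F0: "F > 0" using x0 xy by (simp add: F_def field_simps)
  have grow: "\<exists>n. F + real N * (F\<^sup>2 / l) \<le> 1 / (\<rho> ^^ n) x - 1 / (\<rho> ^^ n) y \<and>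
      1 / l \<le> (\<rho> ^^ n) x \<and> (\<rho> ^^ n) x < (\<rho> ^^ n) y" for N
  proof (induction N)
    case 0
    show ?case using assms(1) xy by (intro exI[of _ 0]) (simp add: F_def)
  next
    case (Suc N)
    then obtain n where n: "F + real N * (F\<^sup>2 / l) \<le> 1 / (\<rho> ^^ n) x - 1 / (\<rho> ^^ n) y"
      "1 / l \<le> (\<rho> ^^ n) x" "(\<rho> ^^ n) x < (\<rho> ^^ n) y" by blast
    define H where "H = 1 / (\<rho> ^^ n) x - 1 / (\<rho> ^^ n) y"
    have "\<And>j. rr p ((\<rho> ^^ j) ((\<rho> ^^ n) x)) = rr p ((\<rho> ^^ j) ((\<rho> ^^ n) y))"
      using assms(2)[of "_ + n"] by (simp add: funpow_add)
    then obtain k where k: "H + H\<^sup>2 / l \<le> 1 / (\<rho> ^^ k) ((\<rho> ^^ n) x) - 1 / (\<rho> ^^ k) ((\<rho> ^^ n) y)"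
      "1 / l \<le> (\<rho> ^^ k) ((\<rho> ^^ n) x)" "(\<rho> ^^ k) ((\<rho> ^^ n) x) < (\<rho> ^^ k) ((\<rho> ^^ n) y)"
      using gap_grows n(2,3) unfolding H_def by blast
    have "0 \<le> real N * (F\<^sup>2 / l)" using l0 by simp
    then have FH: "F \<le> H" using n(1) by (simp add: H_def)
    then have "F\<^sup>2 / l \<le> H\<^sup>2 / l" using F0 l0 by (intro divide_right_mono power_mono) auto
    then have "F + real (Suc N) * (F\<^sup>2 / l) \<le> H + H\<^sup>2 / l"
      using n(1)[folded H_def] by (simp add: algebra_simps add_divide_distrib)
    then show ?case using k by (intro exI[of _ "k + n"]) (auto simp: funpow_add)
  qed
  obtain N where N: "l < real N * (F\<^sup>2 / l)"
    using reals_Archimedean3[of "F\<^sup>2 / l"] F0 l0 by auto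
  obtain n where n: "F + real N * (F\<^sup>2 / l) \<le> 1 / (\<rho> ^^ n) x - 1 / (\<rho> ^^ n) y"
      "1 / l \<le> (\<rho> ^^ n) x" "(\<rho> ^^ n) x < (\<rho> ^^ n) y" using grow by blast
  have pos: "0 < (\<rho> ^^ n) x" using n(2) l0 by (smt (verit) divide_pos_pos)
  then have "1 / (\<rho> ^^ n) x \<le> l" using n(2) l0 by (simp add: field_simps)
  moreover have "0 < 1 / (\<rho> ^^ n) y" using pos n(3) by simp
  ultimately show False using n(1) N F0 by linarith
qed

text \<open>One step of \<open>\<rho>\<close> moves both points into the range at least
  \<open>1 / l\<close>; afterwards \<open>x\<close> is recovered from \<open>\<rho> x\<close> and
  the digit at 0.\<close>

lemma digits_inject:
  assumes "\<And>j. cf_digit p x j = cf_digit p y j"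
  shows "x = y"
proof -
  have d: "rr p ((\<rho> ^^ j) x) = rr p ((\<rho> ^^ j) y)" for j
    using assms by (simp add: cf_digit_eq_rr)
  then have d': "rr p ((\<rho> ^^ j) (\<rho> x)) = rr p ((\<rho> ^^ j) (\<rho> y))" for j
    using d[of "Suc j"] by (simp only: funpow_Suc_right o_apply)
  have "\<rho> x = \<rho> y"
    using digits_not_less[OF rho_ge, of x "\<rho> y"] digits_not_less[OF rho_ge, of y "\<rho> x"] d'
    by (metis linorder_neqE_linordered_idom)
  then have "1 / \<rho> x = 1 / \<rho> y" by simp
  then show ?thesis using d[of 0] by (simp add: inverse_rho)
qed


section \<open>Matrices realising the powers of \<open>\<rho>\<close>\<close>

definition step :: "int \<Rightarrow> mat2" where "step r = (0, 1, -1, real_of_int r * l)"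

text \<open>\<open>P x n\<close> is the matrix of the map \<open>\<rho>\<^sup>n\<close> near \<open>x\<close>. The factor \<open>step r\<close> is the negative
  of \<open>T S\<^sup>-\<^sup>r\<close>, which makes the denominators positive.\<close>

primrec P :: "real \<Rightarrow> nat \<Rightarrow> mat2" where
  "P x 0 = mone"
| "P x (Suc n) = mmul (step (rr p ((\<rho> ^^ n) x))) (P x n)"

lemma P_add: "P x (n + m) = mmul (P ((\<rho> ^^ m) x) n) (P x m)"
  by (induction n) (simp_all add: mmul_assoc funpow_add)

lemma mdet_P: "mdet (P x n) = 1"
  by (induction n) (simp_all add: mdet_mmul, simp_all add: mdet_def step_def)

text \<open>Each step multiplies the denominator by the digit times \<open>l\<close> minus the
  current point, which is positive. This sign later selects the right root in
  \<open>trace_stabilizer_0\<close>.\<close>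

lemma P_apply:
  assumes "P x n = (a,b,c,d)"
  shows "0 < c * x + d" "a * x + b = (c * x + d) * (\<rho> ^^ n) x"
proof -
  have "0 < c * x + d \<and> a * x + b = (c * x + d) * (\<rho> ^^ n) x"
    using assms
  proof (induction n arbitrary: a b c d)
    case (Suc n)
    obtain a' b' c' d' where P: "P x n = (a',b',c',d')" by (metis prod_cases4)
    define y where "y = (\<rho> ^^ n) x"
    have IH: "0 < c' * x + d'" "a' * x + b' = (c' * x + d') * y"
      using Suc.IH[OF P] by (auto simp: y_def)
    have eq: "a = c'" "b = d'" "c = real_of_int (rr p y) * l * c' - a'"
      "d = real_of_int (rr p y) * l * d' - b'"
      using Suc.prems P by (auto simp: mmul_def step_def y_def)
    have rho: "(\<rho> ^^ Suc n) x = 1 / (real_of_int (rr p y) * l - y)"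
      by (simp add: y_def) (simp add: rho_def)
    have "c * x + d = (c' * x + d') * (real_of_int (rr p y) * l - y)"
      using IH(2) by (simp add: eq algebra_simps)
    moreover have "0 < real_of_int (rr p y) * l - y" using rr_bounds[of y] by simp
    ultimately show ?case
      using IH(1) rho by (simp add: eq)
  qed simp
  then show "0 < c * x + d" "a * x + b = (c * x + d) * (\<rho> ^^ n) x" by auto
qed

lemma translation_Gp: "V \<in> Gp p \<Longrightarrow> mmul (1, real_of_int k * l, 0, 1) V \<in> Gp p"
proof (induction k rule: int_induct[where k = 0])
  case (step1 i)
  have "(1, real_of_int (i + 1) * l, 0, 1) = mmul (Smat p) (1, real_of_int i * l, 0, 1)"
    by (simp add: mmul_def Smat_def algebra_simps)
  then show ?case using step1 Gp.S by (simp add: mmul_assoc)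
next
  case (step2 i)
  have "(1, real_of_int (i - 1) * l, 0, 1) = mmul (Sinv p) (1, real_of_int i * l, 0, 1)"
    by (simp add: mmul_def Sinv_def algebra_simps)
  then show ?case using step2 Gp.Si by (simp add: mmul_assoc)
qed simp

lemma P_Gp: "P x n \<in> Gp p"
proof (induction n)
  case (Suc n)
  \<comment> \<open>The square of \<open>T\<close> is minus the identity, so the sign in
    \<open>step\<close> is absorbed by using \<open>T\<close> three times.\<close>
  have "step r = mmul Tmat (mmul Tmat (mmul Tmat (1, real_of_int (- r) * l, 0, 1)))" for r
    by (simp add: step_def mmul_def Tmat_def)
  then show ?case
    using Gp.T[OF Gp.T[OF Gp.T[OF translation_Gp[OF Suc]]]] by (simp only: P.simps mmul_assoc)
qed (simp add: Gp.Id)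

text \<open>These conditions imply \<open>V x = y\<close>. Recording the matrix rules out, for a fixed point \<open>x = y\<close> of a
  hyperbolic \<open>V\<close>, the trivial agreement \<open>m = n\<close>.\<close>

definition tail_equiv :: "mat2 \<Rightarrow> real \<Rightarrow> real \<Rightarrow> bool" where
  "tail_equiv V x y \<longleftrightarrow> (\<exists>m n t. t \<in> {1,-1} \<and> (\<rho> ^^ m) y = (\<rho> ^^ n) x \<and>
     mmul (P y m) V = msmult t (P x n))"

section \<open>Agreement of tails: composition, generators, whole group\<close>

lemma tail_equiv_msmult:
  assumes "tail_equiv V x y" "k \<in> {1,-1}" shows "tail_equiv (msmult k V) x y"
proof -
  obtain m n t where "t \<in> {1,-1}" "(\<rho> ^^ m) y = (\<rho> ^^ n) x" "mmul (P y m) V = msmult t (P x n)"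
    using assms by (auto simp only: tail_equiv_def)
  then show ?thesis using assms(2) unfolding tail_equiv_def
    by (intro exI[of _ m] exI[of _ n] exI[of _ "k*t"]) auto
qed

lemma tail_equiv_mmul:
  assumes "tail_equiv V x y" "tail_equiv W y z" shows "tail_equiv (mmul W V) x z"
proof -
  obtain m n t where 1: "t \<in> {1,-1}" "(\<rho> ^^ m) y = (\<rho> ^^ n) x" "mmul (P y m) V = msmult t (P x n)"
    using assms(1) by (auto simp only: tail_equiv_def)
  obtain m' n' t' where 2: "t' \<in> {1,-1}" "(\<rho> ^^ m') z = (\<rho> ^^ n') y" "mmul (P z m') W = msmult t' (P y n')"
    using assms(2) by (auto simp only: tail_equiv_def)
  \<comment> \<open>Both agreements are prolonged to the same iterate \<open>m + n'\<close> of
    \<open>y\<close>, where they can be chained.\<close>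
  have "mmul (P z (m + m')) W = msmult t' (P y (m + n'))"
    by (simp add: P_add mmul_assoc 2)
  moreover have "mmul (P y (n' + m)) V = msmult t (P x (n' + n))"
    by (simp add: P_add mmul_assoc 1)
  ultimately have "mmul (P z (m + m')) (mmul W V) = msmult (t' * t) (P x (n' + n))"
    by (simp add: mmul_assoc[symmetric] add.commute)
  moreover have "(\<rho> ^^ (m + m')) z = (\<rho> ^^ (n' + n)) x"
    by (metis 1(2) 2(2) add.commute comp_apply funpow_add)
  ultimately show ?thesis using 1(1) 2(1) unfolding tail_equiv_def
    by (intro exI[of _ "m + m'"] exI[of _ "n' + n"] exI[of _ "t' * t"]) auto
qed

lemma tail_equiv_inverse:
  assumes "tail_equiv V x y" "mmul V W = mone" shows "tail_equiv W y x"
proof -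
  obtain m n t where 1: "t \<in> {1,-1}" "(\<rho> ^^ m) y = (\<rho> ^^ n) x" "mmul (P y m) V = msmult t (P x n)"
    using assms(1) by (auto simp only: tail_equiv_def)
  have "P y m = mmul (mmul (P y m) V) W" by (simp add: mmul_assoc assms(2))
  also have "\<dots> = msmult t (mmul (P x n) W)" by (simp add: 1)
  finally have "msmult t (P y m) = mmul (P x n) W" using 1(1) by auto
  then show ?thesis using 1 unfolding tail_equiv_def
    by (intro exI[of _ n] exI[of _ m] exI[of _ t]) auto
qed

lemma tail_equiv_P: "tail_equiv (P x n) x ((\<rho> ^^ n) x)"
  unfolding tail_equiv_def by (intro exI[of _ 0] exI[of _ n] exI[of _ 1]) auto

text \<open>Translation by \<open>l\<close> changes only the first digit.\<close>

lemma tail_equiv_Smat: "tail_equiv (Smat p) x (x + l)"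
proof -
  have "(x + l) / l = x / l + 1" using l_ge_1 by (simp add: field_simps)
  then have r: "rr p (x + l) = rr p x + 1" by (simp add: rr_def)
  then have "\<rho> (x + l) = \<rho> x" by (simp add: rho_def algebra_simps)
  moreover have "mmul (step (rr p x + 1)) (Smat p) = step (rr p x)"
    by (simp add: step_def mmul_def Smat_def algebra_simps)
  ultimately show ?thesis unfolding tail_equiv_def
    by (intro exI[of _ "Suc 0"] exI[of _ 1]) (simp add: r)
qed

lemma tail_equiv_Sinv: "tail_equiv (Sinv p) x (x - l)"
  using tail_equiv_inverse[OF tail_equiv_Smat[of "x - l"], of "Sinv p"]
  by (simp add: mmul_def Smat_def Sinv_def)

text \<open>From cell 0 the first \<open>p - 2\<close> digits are all 1, so \<open>P x j\<close> is
  a power of the elliptic matrix.\<close>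

lemma first_block:
  assumes "cell 0 x" "j \<le> p - 2"
  shows "cell j ((\<rho> ^^ j) x) \<and> P x j = (s (Suc j) - l * s j, s j, - s j, s (Suc j))"
  using assms(2)
proof (induction j)
  case (Suc j)
  then have c: "cell j ((\<rho> ^^ j) x)" "j \<noteq> p - 2" by auto
  show ?case using Suc cell_step[OF c]
    by (auto simp: step_def mmul_def s_rec algebra_simps)
qed (use assms(1) in simp)

lemma first_block_end:
  assumes "cell 0 x"
  shows "P x (p - 2) = (1 - l * l, l, - l, 1)"
    "(\<rho> ^^ (p - 2)) x = ((1 - l * l) * x + l) / (1 - l * x)"
proof -
  have "Suc (p - 2) = p - 1" using p_ge_3 by simp
  then show P: "P x (p - 2) = (1 - l * l, l, - l, 1)"
    using first_block[OF assms, of "p - 2"] s_p_minus_1 s_p_minus_2 by simp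
  show "(\<rho> ^^ (p - 2)) x = ((1 - l * l) * x + l) / (1 - l * x)"
    using P_apply[OF P] by (simp add: field_simps)
qed

text \<open>For \<open>0 < x < 1/l\<close> the expansion of \<open>x\<close> starts with \<open>p - 2\<close> ones, and cancelling the block
  reduces the claim to the point \<open>y\<close> with \<open>1/y = 1/x - l\<close>.\<close>

lemma tail_equiv_Tmat_pos:
  assumes "0 < x" shows "tail_equiv Tmat x (- 1 / x)"
proof -
  \<comment> \<open>Each reduction lowers \<open>1 / x\<close> by \<open>l\<close>, so
    \<open>N\<close> bounds the number of reductions.\<close>
  have "tail_equiv Tmat x (- 1 / x)" if "0 < x" "1 / x \<le> real N * l" for N
    using that
  proof (induction N arbitrary: x)
    case 0
    then show ?case using divide_pos_pos[of 1 x] by simp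
  next
    case (Suc N)
    show ?case
    proof (cases "1 / l \<le> x")
      case True
      then have "1 / x \<le> l" using Suc.prems l_ge_1 by (simp add: field_simps)
      then have r: "rr p (- 1 / x) = 0" using Suc.prems by (intro rr_eqI) auto
      then have "\<rho> (- 1 / x) = x" by (simp add: rho_def)
      then show ?thesis unfolding tail_equiv_def
        by (intro exI[of _ "Suc 0"] exI[of _ 0] exI[of _ 1])
           (use r in \<open>simp add: step_def Tmat_def mmul_def\<close>)
    next
      case False
      then have xl: "x * l < 1" using l_ge_1 by (simp add: field_simps)
      define y where "y = x / (1 - l * x)"
      have y0: "0 < y" using xl Suc.prems by (simp add: y_def mult.commute)
      have iy: "1 / y = 1 / x - l" using xl Suc.prems by (simp add: y_def field_simps)
      have "1 / y \<le> real N * l" using iy Suc.prems(2) by (simp add: algebra_simps)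
      then have T: "tail_equiv Tmat y (- 1 / y)" using Suc.IH y0 by blast
      have c: "cell 0 x" using xl Suc.prems by (simp add: cell_def s_rec)
      have "(\<rho> ^^ (p - 2)) x = y + l"
        using first_block_end(2)[OF c] xl by (simp add: y_def field_simps)
      then have 1: "tail_equiv (P x (p - 2)) x (y + l)" by (metis tail_equiv_P)
      have 2: "tail_equiv (Sinv p) (y + l) y" using tail_equiv_Sinv[of "y + l"] by simp
      have "- 1 / y - l = - 1 / x" using iy by simp
      then have 3: "tail_equiv (Sinv p) (- 1 / y) (- 1 / x)" by (metis tail_equiv_Sinv)
      have "mmul (Sinv p) (mmul Tmat (mmul (Sinv p) (P x (p - 2)))) = Tmat"
        by (simp add: first_block_end(1)[OF c] Sinv_def Tmat_def mmul_def)
      then show ?thesis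
        using tail_equiv_mmul[OF tail_equiv_mmul[OF tail_equiv_mmul[OF 1 2] T] 3] by simp
    qed
  qed
  moreover obtain N where "1 / x \<le> real N * l"
    using reals_Archimedean3[of l] l_ge_1 by (meson less_eq_real_def less_le_trans zero_less_one)
  ultimately show ?thesis using assms by blast
qed

lemma tail_equiv_Tmat:
  assumes "x \<noteq> 0" shows "tail_equiv Tmat x (- 1 / x)"
proof (cases "0 < x")
  \<comment> \<open>The positive case applies to \<open>- 1 / x\<close>; inverting gives the inverse
    of \<open>T\<close>, which is minus \<open>T\<close>.\<close>
  case False
  then have "tail_equiv Tmat (- 1 / x) x"
    using tail_equiv_Tmat_pos[of "- 1 / x"] assms by (simp add: divide_neg_neg)
  then have "tail_equiv (0, 1, -1, 0) x (- 1 / x)"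
    by (rule tail_equiv_inverse) (simp add: Tmat_def mmul_def)
  then show ?thesis using tail_equiv_msmult[of _ _ _ "-1"] by (fastforce simp: msmult_def Tmat_def)
qed (rule tail_equiv_Tmat_pos)

lemma cell_0_0: "cell 0 0"
  by (simp add: cell_def)

lemma rr_l: "rr p l = 2" and rho_l: "\<rho> l = 1 / l" and rho_0: "\<rho> 0 = 1 / l"
proof -
  show "rr p l = 2" using l_ge_1 by (intro rr_eqI) auto
  then show "\<rho> l = 1 / l" by (simp add: rho_def)
  have "rr p 0 = 1" using l_ge_1 by (intro rr_eqI) auto
  then show "\<rho> 0 = 1 / l" by (simp add: rho_def)
qed

lemma rho_orbit_0: "(\<rho> ^^ (p - 2)) 0 = l"
  using first_block_end(2)[OF cell_0_0] by simp

text \<open>The parabolic generator of the stabilizer of \<open>0\<close> is \<open>\<plusminus>T S T\<close>.\<close>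

lemma tail_equiv_parabolic: "tail_equiv (1, 0, - l, 1) 0 0"
proof -
  have "rr p 0 = 1" using l_ge_1 by (intro rr_eqI) auto
  then have "mmul (P 0 (Suc 0)) (1, 0, - l, 1) = P 0 (Suc (p - 2))"
    by (simp add: rho_orbit_0 rr_l first_block_end[OF cell_0_0] step_def mmul_def)
  moreover have "(\<rho> ^^ Suc 0) 0 = (\<rho> ^^ Suc (p - 2)) 0"
    by (simp add: rho_orbit_0 rho_l rho_0)
  ultimately show ?thesis unfolding tail_equiv_def
    by (intro exI[of _ "Suc 0"] exI[of _ "Suc (p - 2)"] exI[of _ 1]) simp
qed

lemma tail_equiv_parabolic_inv: "tail_equiv (1, 0, l, 1) 0 0"
  by (rule tail_equiv_inverse[OF tail_equiv_parabolic]) (simp add: mmul_def)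

text \<open>A word in the generators may send \<open>x\<close> through infinity, so the induction also carries the
  statement for the point \<open>0 = T \<infinity>\<close>.\<close>

lemma tail_equiv_Gp_aux:
  assumes "V \<in> Gp p"
  shows "(acts_real V x \<longrightarrow> tail_equiv V x (moeb V x)) \<and>
         (\<not> acts_real V x \<longrightarrow> tail_equiv (mmul Tmat V) x 0)"
  using assms
proof (induction rule: Gp.induct)
  case Id
  show ?case using tail_equiv_P[of x 0] by (simp add: acts_real_def moeb_def)
next
  case (S V)
  obtain a b c d where V: "V = (a,b,c,d)" by (metis prod_cases4)
  have eq: "mmul (Smat p) V = (a + l * c, b + l * d, c, d)" by (simp add: V Smat_def mmul_def)
  show ?case
  proof (cases "acts_real V x")
    case True
    then have "moeb (mmul (Smat p) V) x = moeb V x + l"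
      unfolding eq by (simp add: V moeb_def acts_real_def field_simps)
    then show ?thesis using True S.IH tail_equiv_mmul tail_equiv_Smat
      unfolding eq by (metis (no_types, lifting) V acts_real_def case_prod_conv eq)
  next
    case False
    \<comment> \<open>Conjugation by \<open>T\<close> carries infinity to 0 and the translation to
      the parabolic map fixing 0.\<close>
    have "mmul Tmat (mmul (Smat p) V) = mmul (1, 0, - l, 1) (mmul Tmat V)"
      by (simp add: V Smat_def Tmat_def mmul_def)
    then show ?thesis using False S.IH tail_equiv_mmul tail_equiv_parabolic
      by (metis (no_types, lifting) V acts_real_def case_prod_conv eq)
  qed
next
  case (Si V)
  obtain a b c d where V: "V = (a,b,c,d)" by (metis prod_cases4)
  have eq: "mmul (Sinv p) V = (a - l * c, b - l * d, c, d)" by (simp add: V Sinv_def mmul_def)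
  show ?case
  proof (cases "acts_real V x")
    case True
    then have "moeb (mmul (Sinv p) V) x = moeb V x - l"
      unfolding eq by (simp add: V moeb_def acts_real_def field_simps)
    then show ?thesis using True Si.IH tail_equiv_mmul tail_equiv_Sinv
      by (metis (no_types, lifting) V acts_real_def case_prod_conv eq)
  next
    case False
    have "mmul Tmat (mmul (Sinv p) V) = mmul (1, 0, l, 1) (mmul Tmat V)"
      by (simp add: V Sinv_def Tmat_def mmul_def)
    then show ?thesis using False Si.IH tail_equiv_mmul tail_equiv_parabolic_inv
      by (metis (no_types, lifting) V acts_real_def case_prod_conv eq)
  qed
next
  case (T V)
  obtain a b c d where V: "V = (a,b,c,d)" by (metis prod_cases4)
  have eq: "mmul Tmat V = (- c, - d, a, b)" by (simp add: V Tmat_def mmul_def)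
  have TT: "mmul Tmat (mmul Tmat V) = msmult (-1) V"
    by (simp add: V Tmat_def mmul_def msmult_def)
  have det: "a * d - b * c = 1" using mdet_Gp[OF T.hyps] by (simp add: V mdet_def)
  \<comment> \<open>\<open>V x\<close> is infinite, zero, or neither; \<open>T\<close> exchanges the
    first two cases.\<close>
  consider "c * x + d = 0" | "c * x + d \<noteq> 0" "a * x + b = 0" | "c * x + d \<noteq> 0" "a * x + b \<noteq> 0"
    by blast
  then show ?case
  proof cases
    case 1
    have "a * (c * x + d) - c * (a * x + b) = 1" using det by (simp add: algebra_simps)
    then have "a * x + b \<noteq> 0" using 1 by auto
    moreover have "- (c * x) - d = 0" using 1 by linarith
    ultimately have "acts_real (mmul Tmat V) x" "moeb (mmul Tmat V) x = 0"
      unfolding eq by (simp_all add: acts_real_def moeb_def)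
    moreover have "\<not> acts_real V x" using 1 by (simp add: V acts_real_def)
    ultimately show ?thesis using T.IH by simp
  next
    case 2
    then have "acts_real V x" "moeb V x = 0" by (simp_all add: V acts_real_def moeb_def)
    then have "tail_equiv V x 0" using T.IH by simp
    then have "tail_equiv (mmul Tmat (mmul Tmat V)) x 0"
      unfolding TT by (rule tail_equiv_msmult) simp
    moreover have "\<not> acts_real (mmul Tmat V) x" using 2 unfolding eq by (simp add: acts_real_def)
    ultimately show ?thesis by simp
  next
    case 3
    have y: "acts_real V x" "moeb V x \<noteq> 0" using 3 by (simp_all add: V acts_real_def moeb_def)
    then have "tail_equiv (mmul Tmat V) x (- 1 / moeb V x)"
      using T.IH tail_equiv_mmul tail_equiv_Tmat by blast
    moreover have "- 1 / moeb V x = moeb (mmul Tmat V) x"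
      unfolding eq using 3 by (simp add: V moeb_def field_simps)
    moreover have "acts_real (mmul Tmat V) x" unfolding eq using 3 by (simp add: acts_real_def)
    ultimately show ?thesis by simp
  qed
qed

lemma tail_equiv_Gp: "V \<in> Gp p \<Longrightarrow> acts_real V x \<Longrightarrow> tail_equiv V x (moeb V x)"
  using tail_equiv_Gp_aux by blast

section \<open>The stabilizer of 0 and the excluded period\<close>

lemma P_0_column:
  assumes "P 0 n = (a,b,c,d)"
  shows "b\<^sup>2 - l * b * d + d\<^sup>2 = 1"
proof -
  \<comment> \<open>The column runs through consecutive values of \<open>s\<close>, indexed by the
    current cell.\<close>
  have "\<exists>i. cell i ((\<rho> ^^ n) 0) \<and> b = s i \<and> d = s (Suc i)"
    using assms
  proof (induction n arbitrary: a b c d)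
    case 0
    then show ?case using cell_0_0 by (intro exI[of _ 0]) auto
  next
    case (Suc n)
    obtain a' b' c' d' where P: "P 0 n = (a',b',c',d')" by (metis prod_cases4)
    define y where "y = (\<rho> ^^ n) 0"
    obtain i where i: "cell i y" "b' = s i" "d' = s (Suc i)" using Suc.IH[OF P] by (auto simp: y_def)
    have eq: "b = d'" "d = real_of_int (rr p y) * l * d' - b'"
      using Suc.prems P by (auto simp: mmul_def step_def y_def)
    show ?case
    proof (cases "i = p - 2")
      case False
      then show ?thesis using cell_step[OF i(1)] i eq
        by (intro exI[of _ "Suc i"]) (auto simp: s_rec y_def)
    next
      \<comment> \<open>In the last cell the column is \<open>(l, 1)\<close>, so the point is
        \<open>l\<close>; its digit 2 restarts the column at \<open>(s 1, s 2)\<close>.\<close>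
      case True
      moreover have "Suc (p - 2) = p - 1" using p_ge_3 by simp
      ultimately have bd: "b' = l" "d' = 1" using i s_p_minus_1 s_p_minus_2 by auto
      then have "y = l" using P_apply(2)[OF P] by (simp add: y_def)
      then have "b = s (Suc 0)" "d = s (Suc (Suc 0))" "(\<rho> ^^ Suc n) 0 = 1 / l"
        by (simp_all add: eq bd rr_l s_rec rho_l y_def)
      moreover have "cell (Suc 0) (1 / l)"
        using p_ge_3 l_ge_1 by (auto simp: cell_def s_rec field_simps)
      ultimately show ?thesis by auto
    qed
  qed
  then show ?thesis using s_norm by auto
qed

lemma trace_stabilizer_0:
  assumes "tail_equiv V 0 0" "mdet V = 1" shows "\<bar>trace2 V\<bar> = 2"
proof -
  obtain m n t where t: "t \<in> {1,-1}" "(\<rho> ^^ m) 0 = (\<rho> ^^ n) 0" "mmul (P 0 m) V = msmult t (P 0 n)"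
    using assms(1) by (auto simp only: tail_equiv_def)
  obtain a b c d where P: "P 0 m = (a,b,c,d)" by (metis prod_cases4)
  obtain a' b' c' d' where P': "P 0 n = (a',b',c',d')" by (metis prod_cases4)
  obtain e f g h where V: "V = (e,f,g,h)" by (metis prod_cases4)
  define y where "y = (\<rho> ^^ m) 0"
  have d: "0 < d" "b = d * y" "0 < d'" "b' = d' * y"
    using P_apply[OF P] P_apply[OF P'] t(2) by (auto simp: y_def)
  have "d\<^sup>2 * (y\<^sup>2 - l * y + 1) = 1" "d'\<^sup>2 * (y\<^sup>2 - l * y + 1) = 1"
    using P_0_column[OF P] P_0_column[OF P'] by (simp_all add: d power2_eq_square algebra_simps)
  then have "d\<^sup>2 = d'\<^sup>2" by (metis mult_cancel_right zero_neq_one mult_zero_right)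
  then have dd: "d' = d" "b' = b" using d by (auto simp: power2_eq_iff_nonneg)
  \<comment> \<open>The second columns now agree, so the invertible \<open>P 0 m\<close> annihilates
    \<open>(f, h - t)\<close>.\<close>
  have eqs: "a * f + b * (h - t) = 0" "c * f + d * (h - t) = 0"
    using t(3) by (simp_all add: P P' V dd mmul_def msmult_def algebra_simps)
  have det: "a * d - b * c = 1" using mdet_P[of 0 m] by (simp add: P mdet_def)
  have "(a * d - b * c) * f = 0" "(a * d - b * c) * (h - t) = 0" using eqs by algebra+
  then have "f = 0" "h = t" using det by auto
  then have "e * t = 1" using assms(2) by (simp add: V mdet_def)
  then show ?thesis using t(1) \<open>h = t\<close> by (auto simp: V trace2_def)
qed

text \<open>Since \<open>l\<close> is on the orbit of 0, \<open>V\<close> is conjugate to a matrix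
  with tail agreement at 0, and conjugation keeps the trace.\<close>

lemma trace_if_reaches_l:
  assumes "tail_equiv V x x" "mdet V = 1" "(\<rho> ^^ N) x = l"
  shows "\<bar>trace2 V\<bar> = 2"
proof -
  define B where "B = P 0 (p - 2)"
  define C where "C = mmul (madj B) (P x N)"
  have det_madj: "mdet (madj M) = mdet M" for M
    by (cases M) (simp add: madj_def mdet_def)
  have "tail_equiv B 0 l" using tail_equiv_P[of 0 "p - 2"] by (simp add: B_def rho_orbit_0)
  then have "tail_equiv (madj B) l 0"
    by (rule tail_equiv_inverse) (simp add: madj_inverse B_def mdet_P)
  moreover have "tail_equiv (P x N) x l" using tail_equiv_P[of x N] assms(3) by simp
  ultimately have C: "tail_equiv C x 0" unfolding C_def using tail_equiv_mmul by blast
  have dC: "mdet C = 1" by (simp add: C_def mdet_mmul det_madj mdet_P B_def)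
  have "tail_equiv (madj C) 0 x" using C by (rule tail_equiv_inverse) (simp add: madj_inverse dC)
  then have "tail_equiv (mmul C (mmul V (madj C))) 0 0"
    using C assms(1) tail_equiv_mmul by blast
  then have "\<bar>trace2 (mmul C (mmul V (madj C)))\<bar> = 2"
    by (rule trace_stabilizer_0) (simp add: mdet_mmul det_madj dC assms(2))
  then show ?thesis
    by (simp add: trace2_mmul_commute[of C] mmul_assoc madj_inverse dC)
qed

text \<open>The point \<open>l\<close> has digits 2,1,...,1 repeated, so a suitable tail of
  \<open>x\<close> shares all its digits.\<close>

lemma special_reaches_l:
  assumes "special_period p x" shows "\<exists>N. (\<rho> ^^ N) x = l"
proof -
  obtain k where k: "\<And>j. cf_digit p x j = (if (j + k) mod (p - 2) = 0 then 2 else 1)"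
    using assms by (auto simp: special_period_def)
  have orbit: "(\<rho> ^^ Suc j) l = (\<rho> ^^ Suc j) 0" for j
    by (simp only: funpow_Suc_right o_apply rho_l rho_0)
  have "p - 2 = Suc (p - 3)" using p_ge_3 by simp
  then have per: "(\<rho> ^^ (p - 2)) l = l" using orbit[of "p - 3"] rho_orbit_0 by simp
  have dig: "cf_digit p l j = (if j mod (p - 2) = 0 then 2 else 1)" for j
  proof -
    define i where "i = j mod (p - 2)"
    have "cf_digit p l j = rr p ((\<rho> ^^ i) l)"
      using funpow_mod_eq[OF per, of j] by (simp add: cf_digit_eq_rr i_def)
    moreover have "rr p ((\<rho> ^^ i) l) = 1" if "i \<noteq> 0"
    proof -
      have "i < p - 2" using p_ge_3 by (simp add: i_def)
      then show ?thesis
        using first_block[OF cell_0_0, of i] cell_step(1)[of i "(\<rho> ^^ i) 0"] orbit[of "i - 1"] that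
        by simp
    qed
    ultimately show ?thesis by (auto simp: i_def[symmetric] rr_l)
  qed
  \<comment> \<open>This shift makes \<open>N + k\<close> a multiple of
    \<open>p - 2\<close>.\<close>
  define N where "N = k * (p - 3)"
  have "N + k = k * (p - 2)" using \<open>p - 2 = Suc (p - 3)\<close> by (simp add: N_def)
  then have "(j + N + k) mod (p - 2) = j mod (p - 2)" for j
    by (simp add: add.assoc)
  then have "(\<rho> ^^ N) x = l"
    by (intro digits_inject) (simp add: cf_digit_rho k dig)
  then show ?thesis ..
qed

section \<open>Periodicity and reduced numbers\<close>

lemma hyperbolic_eventually_periodic:
  assumes "tail_equiv V x x" "mdet V = 1" "\<bar>trace2 V\<bar> > 2"
  shows "\<exists>N k. 1 \<le> k \<and> (\<rho> ^^ k) ((\<rho> ^^ N) x) = (\<rho> ^^ N) x"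
proof -
  obtain m n t where t: "t \<in> {1,-1}" "(\<rho> ^^ m) x = (\<rho> ^^ n) x" "mmul (P x m) V = msmult t (P x n)"
    using assms(1) by (auto simp only: tail_equiv_def)
  \<comment> \<open>Otherwise \<open>P x m\<close> cancels and leaves plus or minus the
    identity.\<close>
  have "m \<noteq> n"
  proof
    assume "m = n"
    then have "mmul (madj (P x m)) (mmul (P x m) V) = mmul (madj (P x m)) (msmult t (P x m))"
      using t(3) by simp
    then have "V = msmult t mone"
      by (simp add: mmul_assoc[symmetric] madj_inverse mdet_P)
    then show False using assms(3) t(1) by (auto simp: msmult_def trace2_def)
  qed
  then consider k where "1 \<le> k" "n = k + m" | k where "1 \<le> k" "m = k + n"
    by (metis add.commute le_add_diff_inverse2 less_eq_Suc_le linorder_neqE_nat nat_less_le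
        One_nat_def zero_less_diff)
  then show ?thesis
  proof cases
    case 1
    then show ?thesis using t(2) by (intro exI[of _ m] exI[of _ k]) (simp add: funpow_add)
  next
    case 2
    then show ?thesis using t(2) by (intro exI[of _ n] exI[of _ k]) (simp add: funpow_add)
  qed
qed

lemma purely_periodic_iff: "purely_periodic p x \<longleftrightarrow> (\<exists>k\<ge>1. (\<rho> ^^ k) x = x)"
proof
  assume "purely_periodic p x"
  then obtain k where "k \<ge> 1" "\<And>j. cf_digit p x (j + k) = cf_digit p x j"
    by (auto simp: purely_periodic_def)
  then show "\<exists>k\<ge>1. (\<rho> ^^ k) x = x"
    by (intro exI[of _ k] conjI digits_inject) (auto simp: cf_digit_rho)
next
  assume "\<exists>k\<ge>1. (\<rho> ^^ k) x = x"
  then show "purely_periodic p x" unfolding purely_periodic_def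
    by (metis cf_digit_rho)
qed

lemma hyp_fixed_reaches_reduced:
  assumes "hyp_fixed p x" shows "\<exists>n. reduced p ((\<rho> ^^ n) x)"
proof -
  obtain V where V: "V \<in> Gp p" "\<bar>trace2 V\<bar> > 2" "acts_real V x" "moeb V x = x"
    using assms by (auto simp: hyp_fixed_def)
  have E: "tail_equiv V x x" using tail_equiv_Gp[OF V(1,3)] V(4) by simp
  obtain N k where "1 \<le> k" "(\<rho> ^^ k) ((\<rho> ^^ N) x) = (\<rho> ^^ N) x"
    using hyperbolic_eventually_periodic[OF E mdet_Gp[OF V(1)] V(2)] by blast
  then have "purely_periodic p ((\<rho> ^^ N) x)" by (auto simp: purely_periodic_iff)
  moreover have "\<not> special_period p ((\<rho> ^^ N) x)"
  proof
    assume "special_period p ((\<rho> ^^ N) x)"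
    then obtain M where "(\<rho> ^^ (M + N)) x = l"
      using special_reaches_l by (auto simp: funpow_add)
    then show False using trace_if_reaches_l[OF E mdet_Gp[OF V(1)]] V(2) by fastforce
  qed
  ultimately show ?thesis by (auto simp: reduced_def)
qed

lemma reduced_rho:
  assumes "reduced p x" shows "reduced p (\<rho> x)"
proof -
  have d: "cf_digit p (\<rho> x) j = cf_digit p x (Suc j)" for j
    using cf_digit_rho[of p 1 x j] by simp
  obtain k where k: "k \<ge> 1" "\<And>j. cf_digit p x (j + k) = cf_digit p x j"
    using assms by (auto simp: reduced_def purely_periodic_def)
  have "purely_periodic p (\<rho> x)"
    using k(1) k(2)[of "Suc _"] unfolding purely_periodic_def d by (intro exI[of _ k]) auto
  moreover have "\<not> special_period p (\<rho> x)"
  proof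
    assume "special_period p (\<rho> x)"
    then obtain i where i: "\<And>j. cf_digit p x (Suc j) = (if (j + i) mod (p - 2) = 0 then 2 else 1)"
      by (auto simp: special_period_def d)
    \<comment> \<open>Instead of shifting back by one, periodicity permits a forward shift by
      \<open>k - 1\<close>, which also recovers the digit at 0.\<close>
    have "cf_digit p x j = (if (j + (k - 1 + i)) mod (p - 2) = 0 then 2 else 1)" for j
      using k(2)[of j] i[of "j + (k - 1)"] k(1) by (simp add: add.assoc)
    then have "special_period p x" unfolding special_period_def by blast
    then show False using assms by (simp add: reduced_def)
  qed
  ultimately show ?thesis by (simp add: reduced_def)
qed

text \<open>The tail agreement can be run around the cycle of \<open>y\<close> arbitrarily often.
  The bound \<open>K\<close> serves to reach \<open>y\<close> beyond an iterate of \<open>x\<close>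
  already known to be reduced.\<close>

lemma reduced_tail:
  assumes "reduced p y" "V \<in> Gp p" "acts_real V x" "y = moeb V x"
  shows "\<exists>n\<ge>K. y = (\<rho> ^^ n) x"
proof -
  obtain m n where mn: "(\<rho> ^^ m) y = (\<rho> ^^ n) x"
    using tail_equiv_Gp[OF assms(2,3)] assms(4) by (auto simp only: tail_equiv_def)
  obtain k where k: "k \<ge> 1" "(\<rho> ^^ k) y = y"
    using assms(1) by (auto simp: reduced_def purely_periodic_iff)
  \<comment> \<open>A multiple of the period, large enough to pass \<open>m\<close> with
    \<open>K\<close> steps to spare.\<close>
  define q where "q = k * (m + K)"
  have q: "m + K \<le> q" using k(1) by (simp add: q_def)
  have "y = (\<rho> ^^ q) y"
    using funpow_mod_eq[OF k(2), of q] by (simp add: q_def)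
  also have "\<dots> = (\<rho> ^^ (q - m)) ((\<rho> ^^ m) y)"
    using q funpow_add[of "q - m" m \<rho>] by simp
  also have "\<dots> = (\<rho> ^^ (q - m + n)) x" by (simp add: mn funpow_add)
  finally show ?thesis using q by (intro exI[of _ "q - m + n"]) auto
qed

lemma Gp_equiv_iterate: "Gp_equiv p x ((\<rho> ^^ n) x)"
proof -
  obtain a b c d where P: "P x n = (a,b,c,d)" by (metis prod_cases4)
  have "acts_real (P x n) x" "(\<rho> ^^ n) x = moeb (P x n) x"
    using P_apply[OF P] by (simp_all add: P acts_real_def moeb_def)
  then show ?thesis using P_Gp unfolding Gp_equiv_def by blast
qed

end

theorem theorem5p1:
  fixes p :: nat
  assumes "p \<ge> 3"
  shows "(\<forall>\<alpha>. hyp_fixed p \<alpha> \<longrightarrow> (\<exists>n. reduced p ((rho p ^^ n) \<alpha>)))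
       \<and> (\<forall>\<beta>. reduced p \<beta> \<longrightarrow> reduced p (rho p \<beta>) \<and> (\<exists>m \<ge> 1. (rho p ^^ m) \<beta> = \<beta>))
       \<and> (\<forall>\<beta> \<gamma>. reduced p \<beta> \<and> reduced p \<gamma> \<and> Gp_equiv p \<beta> \<gamma>
                 \<longrightarrow> (\<exists>n. \<gamma> = (rho p ^^ n) \<beta>))
       \<and> (\<forall>\<alpha>. hyp_fixed p \<alpha> \<longrightarrow>
            (\<exists>\<beta>. reduced p \<beta> \<and> Gp_equiv p \<alpha> \<beta> \<and>
               (\<forall>\<gamma>. reduced p \<gamma> \<and> Gp_equiv p \<alpha> \<gamma> \<longrightarrow> (\<exists>n. \<gamma> = (rho p ^^ n) \<beta>))))"
proof -
  interpret hecke p by unfold_locales (rule assms)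
  have cycle: "\<exists>m\<ge>1. (rho p ^^ m) \<beta> = \<beta>" if "reduced p \<beta>" for \<beta>
    using that by (simp add: reduced_def purely_periodic_iff)
  have same: "\<exists>n\<ge>K. \<gamma> = (rho p ^^ n) \<beta>" if "reduced p \<gamma>" "Gp_equiv p \<beta> \<gamma>" for \<beta> \<gamma> K
    using that reduced_tail unfolding Gp_equiv_def by blast
  have unique: "\<exists>\<beta>. reduced p \<beta> \<and> Gp_equiv p \<alpha> \<beta> \<and>
      (\<forall>\<gamma>. reduced p \<gamma> \<and> Gp_equiv p \<alpha> \<gamma> \<longrightarrow> (\<exists>n. \<gamma> = (rho p ^^ n) \<beta>))" if hyp: "hyp_fixed p \<alpha>" for \<alpha>
  proof -
    obtain N where N: "reduced p ((rho p ^^ N) \<alpha>)" using hyp_fixed_reaches_reduced[OF hyp] by blast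
    have "\<exists>n. \<gamma> = (rho p ^^ n) ((rho p ^^ N) \<alpha>)" if \<gamma>: "reduced p \<gamma>" "Gp_equiv p \<alpha> \<gamma>" for \<gamma>
    proof -
      obtain n where "n \<ge> N" "\<gamma> = (rho p ^^ n) \<alpha>" using same \<gamma> by blast
      then show ?thesis using funpow_add[of "n - N" N "rho p"] by (intro exI[of _ "n - N"]) simp
    qed
    then show ?thesis using N Gp_equiv_iterate by blast
  qed
  show ?thesis using hyp_fixed_reaches_reduced reduced_rho cycle same unique by blast
qed

end
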